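(* Each of the following three decision problems subsumes the analytical hierarchy (i.e. every set $X\subseteq\mathbb N$ in $\Sigma^1_n$ or $\Pi^1_n$ for some $n$ is many-one reducible to it). Input: an equational bitstream specification $E$ over a bitstream signature $\Sigma$ and a ground term $t$ of sort $S$. Question: does $t$ have (i) a solution, (ii) a unique solution, (iii) at most one solution, over all full models of $E$; i.e. is $|\mathrm{sol}_{\mathrm{full}}(t,E)|\ge1$, $=1$, $\le1$, respectively?
   Context: Sorts are $B$ (bits) and $S$ (bitstreams). A bitstream signature $\Sigma$ is a set of function symbols, each with a type $f :: s_1\times\cdots\times s_n\to s$ with $s_i,s\in\{B,S\}$, containing $0,1::B$ and the infix stream constructor $:\,::B\times S\to S$. An equational bitstream specification over $\Sigma$ is a finite set of equations between sorted terms of the same sort (terms may contain sorted variables). A stream algebra $\mathcal{A}=\langle A,[\![\cdot]\!]\rangle$ consists of $A_B=\{0,1\}$, a nonempty $A_S\subseteq\{0,1\}^{\mathbb N}$, and functions $[\![f]\!]:A_{s_1}\times\cdots\times A_{s_n}\to A_s$ for each symbol, with $[\![:]\!](x,\sigma)=x:\sigma$, $[\![0]\!]=0$, $[\![1]\!]=1$. $\mathcal A$ is a model of $E$ if both sides of every equation of $E$ have equal interpretations under every sort-respecting variable assignment into $A$; $\mathcal A$ is full if $A_S=\{0,1\}^{\mathbb N}$. For a ground term $t$ of sort $S$, $\mathrm{sol}_{\mathrm{full}}(t,E)=\{[\![t]\!]^{\mathcal A}\mid \mathcal A\text{ full},\ \mathcal A\text{ a model of }E\}$. Instances are coded as natural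 numbers; many-one reductions are by partial recursive functions. *)

theory Defs
  imports Main "HOL-Library.Nat_Bijection"
begin

section \<open>Partial recursive functions and many-one reducibility\<close>

definition minimize :: "(nat \<Rightarrow> nat option) \<Rightarrow> nat option" where
  "minimize p =
     (if \<exists>y. p y = Some 0 \<and> (\<forall>z<y. \<exists>v. p z = Some (Suc v))
      then Some (LEAST y. p y = Some 0) else None)"

text \<open>An \<open>n\<close>-ary partial function is given by its values on argument lists of length \<open>n\<close>;
  its values on lists of other lengths carry no meaning.\<close>

inductive partrec :: "nat \<Rightarrow> (nat list \<Rightarrow> nat option) \<Rightarrow> bool" where
  zero: "partrec n (\<lambda>xs. Some 0)"
| succ: "partrec 1 (\<lambda>xs. Some (Suc (hd xs)))"
| proj: "i < n \<Longrightarrow> partrec n (\<lambda>xs. Some (xs ! i))"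
| comp: "partrec (length gs) f \<Longrightarrow> (\<forall>g\<in>set gs. partrec n g) \<Longrightarrow>
    partrec n (\<lambda>xs. Option.bind (those (map (\<lambda>g. g xs) gs)) f)"
| prec: "partrec n f \<Longrightarrow> partrec (Suc (Suc n)) g \<Longrightarrow>
    partrec (Suc n) (\<lambda>xs. rec_nat (f (tl xs))
      (\<lambda>i r. Option.bind r (\<lambda>v. g (i # v # tl xs))) (hd xs))"
| mu: "partrec (Suc n) f \<Longrightarrow> partrec n (\<lambda>xs. minimize (\<lambda>y. f (y # xs)))"

text \<open>The reducing function may be partial; where it is undefined, its value does not count
  as an element of \<open>Y\<close>.\<close>

definition many_one_reducible :: "nat set \<Rightarrow> nat set \<Rightarrow> bool" where
  "many_one_reducible X Y \<longleftrightarrow>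
     (\<exists>f. partrec 1 f \<and> (\<forall>x. x \<in> X \<longleftrightarrow> (\<exists>y. f [x] = Some y \<and> y \<in> Y)))"


section \<open>The analytical hierarchy\<close>

text \<open>Formulas of second-order arithmetic with number variables (\<open>NVar\<close>) and variables for
  functions from numbers to numbers (\<open>FApp F\<close> applies the function variable \<open>F\<close>).\<close>

datatype aterm =
    NVar nat
  | NZero
  | NSuc aterm
  | NAdd aterm aterm
  | NMul aterm aterm
  | FApp nat aterm

datatype aform =
    AEq aterm aterm
  | ANeg aform
  | AAnd aform aform
  | AOr aform aform
  | AllN nat aform
  | ExN nat aform
  | AllF nat aform
  | ExF nat aform

primrec aeval :: "(nat \<Rightarrow> nat) \<Rightarrow> (nat \<Rightarrow> nat \<Rightarrow> nat) \<Rightarrow> aterm \<Rightarrow> nat" where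
  "aeval e h (NVar x) = e x"
| "aeval e h NZero = 0"
| "aeval e h (NSuc a) = Suc (aeval e h a)"
| "aeval e h (NAdd a b) = aeval e h a + aeval e h b"
| "aeval e h (NMul a b) = aeval e h a * aeval e h b"
| "aeval e h (FApp F a) = h F (aeval e h a)"

primrec asat :: "(nat \<Rightarrow> nat) \<Rightarrow> (nat \<Rightarrow> nat \<Rightarrow> nat) \<Rightarrow> aform \<Rightarrow> bool" where
  "asat e h (AEq a b) \<longleftrightarrow> aeval e h a = aeval e h b"
| "asat e h (ANeg \<phi>) \<longleftrightarrow> \<not> asat e h \<phi>"
| "asat e h (AAnd \<phi> \<psi>) \<longleftrightarrow> asat e h \<phi> \<and> asat e h \<psi>"
| "asat e h (AOr \<phi> \<psi>) \<longleftrightarrow> asat e h \<phi> \<or> asat e h \<psi>"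
| "asat e h (AllN x \<phi>) \<longleftrightarrow> (\<forall>k. asat (e(x := k)) h \<phi>)"
| "asat e h (ExN x \<phi>) \<longleftrightarrow> (\<exists>k. asat (e(x := k)) h \<phi>)"
| "asat e h (AllF F \<phi>) \<longleftrightarrow> (\<forall>g. asat e (h(F := g)) \<phi>)"
| "asat e h (ExF F \<phi>) \<longleftrightarrow> (\<exists>g. asat e (h(F := g)) \<phi>)"

primrec nvars :: "aterm \<Rightarrow> nat set" where
  "nvars (NVar x) = {x}"
| "nvars NZero = {}"
| "nvars (NSuc a) = nvars a"
| "nvars (NAdd a b) = nvars a \<union> nvars b"
| "nvars (NMul a b) = nvars a \<union> nvars b"
| "nvars (FApp F a) = nvars a"

primrec fvars :: "aterm \<Rightarrow> nat set" where
  "fvars (NVar x) = {}"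
| "fvars NZero = {}"
| "fvars (NSuc a) = fvars a"
| "fvars (NAdd a b) = fvars a \<union> fvars b"
| "fvars (NMul a b) = fvars a \<union> fvars b"
| "fvars (FApp F a) = insert F (fvars a)"

primrec free_nvars :: "aform \<Rightarrow> nat set" where
  "free_nvars (AEq a b) = nvars a \<union> nvars b"
| "free_nvars (ANeg \<phi>) = free_nvars \<phi>"
| "free_nvars (AAnd \<phi> \<psi>) = free_nvars \<phi> \<union> free_nvars \<psi>"
| "free_nvars (AOr \<phi> \<psi>) = free_nvars \<phi> \<union> free_nvars \<psi>"
| "free_nvars (AllN x \<phi>) = free_nvars \<phi> - {x}"
| "free_nvars (ExN x \<phi>) = free_nvars \<phi> - {x}"
| "free_nvars (AllF F \<phi>) = free_nvars \<phi>"
| "free_nvars (ExF F \<phi>) = free_nvars \<phi>"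

primrec free_fvars :: "aform \<Rightarrow> nat set" where
  "free_fvars (AEq a b) = fvars a \<union> fvars b"
| "free_fvars (ANeg \<phi>) = free_fvars \<phi>"
| "free_fvars (AAnd \<phi> \<psi>) = free_fvars \<phi> \<union> free_fvars \<psi>"
| "free_fvars (AOr \<phi> \<psi>) = free_fvars \<phi> \<union> free_fvars \<psi>"
| "free_fvars (AllN x \<phi>) = free_fvars \<phi>"
| "free_fvars (ExN x \<phi>) = free_fvars \<phi>"
| "free_fvars (AllF F \<phi>) = free_fvars \<phi> - {F}"
| "free_fvars (ExF F \<phi>) = free_fvars \<phi> - {F}"

primrec arithmetical :: "aform \<Rightarrow> bool" where
  "arithmetical (AEq a b) \<longleftrightarrow> True"
| "arithmetical (ANeg \<phi>) \<longleftrightarrow> arithmetical \<phi>"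
| "arithmetical (AAnd \<phi> \<psi>) \<longleftrightarrow> arithmetical \<phi> \<and> arithmetical \<psi>"
| "arithmetical (AOr \<phi> \<psi>) \<longleftrightarrow> arithmetical \<phi> \<and> arithmetical \<psi>"
| "arithmetical (AllN x \<phi>) \<longleftrightarrow> arithmetical \<phi>"
| "arithmetical (ExN x \<phi>) \<longleftrightarrow> arithmetical \<phi>"
| "arithmetical (AllF F \<phi>) \<longleftrightarrow> False"
| "arithmetical (ExF F \<phi>) \<longleftrightarrow> False"

text \<open>Prefixes of \<open>n\<close> alternating, possibly empty blocks of function quantifiers in front of
  an arithmetical formula.\<close>

inductive sigma11_form :: "nat \<Rightarrow> aform \<Rightarrow> bool" and pi11_form :: "nat \<Rightarrow> aform \<Rightarrow> bool" where
  sigma_arith: "arithmetical \<phi> \<Longrightarrow> sigma11_form 0 \<phi>"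
| pi_arith: "arithmetical \<phi> \<Longrightarrow> pi11_form 0 \<phi>"
| sigma_pi: "pi11_form n \<phi> \<Longrightarrow> sigma11_form (Suc n) \<phi>"
| pi_sigma: "sigma11_form n \<phi> \<Longrightarrow> pi11_form (Suc n) \<phi>"
| sigma_ex: "sigma11_form (Suc n) \<phi> \<Longrightarrow> sigma11_form (Suc n) (ExF F \<phi>)"
| pi_all: "pi11_form (Suc n) \<phi> \<Longrightarrow> pi11_form (Suc n) (AllF F \<phi>)"

text \<open>The hierarchy is the lightface one: number variable \<open>0\<close> is the only free variable, so
  there are no parameters, and the default values used in \<open>defined_set\<close> are irrelevant.\<close>

definition defined_set :: "aform \<Rightarrow> nat set" where
  "defined_set \<phi> = {x. asat ((\<lambda>_. 0)(0 := x)) (\<lambda>_ _. 0) \<phi>}"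

definition Sigma11 :: "nat \<Rightarrow> nat set set" where
  "Sigma11 n = {defined_set \<phi> | \<phi>.
     sigma11_form n \<phi> \<and> free_nvars \<phi> \<subseteq> {0} \<and> free_fvars \<phi> = {}}"

definition Pi11 :: "nat \<Rightarrow> nat set set" where
  "Pi11 n = {defined_set \<phi> | \<phi>.
     pi11_form n \<phi> \<and> free_nvars \<phi> \<subseteq> {0} \<and> free_fvars \<phi> = {}}"

definition subsumes_analytical_hierarchy :: "nat set \<Rightarrow> bool" where
  "subsumes_analytical_hierarchy P \<longleftrightarrow>
     (\<forall>n. \<forall>X \<in> Sigma11 n \<union> Pi11 n. many_one_reducible X P)"


section \<open>Equational bitstream specifications\<close>

datatype srt = Bit | Stream

text \<open>Function symbols carry their types: \<open>Fn k [s\<^sub>1, \<dots>, s\<^sub>n] s\<close> is the symbol with name \<open>k\<close>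
  and type \<open>s\<^sub>1 \<times> \<dots> \<times> s\<^sub>n \<rightarrow> s\<close>.\<close>

datatype fsym = Zero | One | SCons | Fn nat "srt list" srt

primrec arg_sorts :: "fsym \<Rightarrow> srt list" where
  "arg_sorts Zero = []"
| "arg_sorts One = []"
| "arg_sorts SCons = [Bit, Stream]"
| "arg_sorts (Fn k ss s) = ss"

primrec res_sort :: "fsym \<Rightarrow> srt" where
  "res_sort Zero = Bit"
| "res_sort One = Bit"
| "res_sort SCons = Stream"
| "res_sort (Fn k ss s) = s"

definition bitstream_signature :: "fsym set \<Rightarrow> bool" where
  "bitstream_signature \<Sigma> \<longleftrightarrow> {Zero, One, SCons} \<subseteq> \<Sigma>"

datatype trm = Var srt nat | App fsym "trm list"

fun sort_of :: "trm \<Rightarrow> srt" where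
  "sort_of (Var s x) = s"
| "sort_of (App f ts) = res_sort f"

fun wf_trm :: "fsym set \<Rightarrow> trm \<Rightarrow> bool" where
  "wf_trm \<Sigma> (Var s x) \<longleftrightarrow> True"
| "wf_trm \<Sigma> (App f ts) \<longleftrightarrow>
     f \<in> \<Sigma> \<and> map sort_of ts = arg_sorts f \<and> (\<forall>t\<in>set ts. wf_trm \<Sigma> t)"

fun ground :: "trm \<Rightarrow> bool" where
  "ground (Var s x) \<longleftrightarrow> False"
| "ground (App f ts) \<longleftrightarrow> (\<forall>t\<in>set ts. ground t)"

definition bitstream_spec :: "fsym set \<Rightarrow> (trm \<times> trm) set \<Rightarrow> bool" where
  "bitstream_spec \<Sigma> E \<longleftrightarrow> finite E \<and>
     (\<forall>(l, r)\<in>E. wf_trm \<Sigma> l \<and> wf_trm \<Sigma> r \<and> sort_of l = sort_of r)"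

text \<open>The bits \<open>0\<close> and \<open>1\<close> are represented by \<^const>\<open>False\<close> and \<^const>\<open>True\<close>.\<close>

datatype val = BitV bool | StreamV "nat \<Rightarrow> bool"

record alg =
  streams :: "(nat \<Rightarrow> bool) set"
  interp :: "fsym \<Rightarrow> val list \<Rightarrow> val"

fun carrier_of :: "alg \<Rightarrow> srt \<Rightarrow> val set" where
  "carrier_of A Bit = range BitV"
| "carrier_of A Stream = StreamV ` streams A"

definition stream_algebra :: "fsym set \<Rightarrow> alg \<Rightarrow> bool" where
  "stream_algebra \<Sigma> A \<longleftrightarrow>
     streams A \<noteq> {} \<and>
     (\<forall>f\<in>\<Sigma>. \<forall>vs. list_all2 (\<lambda>v s. v \<in> carrier_of A s) vs (arg_sorts f) \<longrightarrow>
        interp A f vs \<in> carrier_of A (res_sort f)) \<and>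
     interp A Zero [] = BitV False \<and>
     interp A One [] = BitV True \<and>
     (\<forall>b. \<forall>\<sigma>\<in>streams A.
        interp A SCons [BitV b, StreamV \<sigma>] = StreamV (case_nat b \<sigma>))"

definition full :: "alg \<Rightarrow> bool" where
  "full A \<longleftrightarrow> streams A = UNIV"

definition assignment :: "alg \<Rightarrow> (srt \<Rightarrow> nat \<Rightarrow> val) \<Rightarrow> bool" where
  "assignment A \<rho> \<longleftrightarrow> (\<forall>s x. \<rho> s x \<in> carrier_of A s)"

fun eval_trm :: "alg \<Rightarrow> (srt \<Rightarrow> nat \<Rightarrow> val) \<Rightarrow> trm \<Rightarrow> val" where
  "eval_trm A \<rho> (Var s x) = \<rho> s x"
| "eval_trm A \<rho> (App f ts) = interp A f (map (eval_trm A \<rho>) ts)"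

definition model :: "fsym set \<Rightarrow> (trm \<times> trm) set \<Rightarrow> alg \<Rightarrow> bool" where
  "model \<Sigma> E A \<longleftrightarrow> stream_algebra \<Sigma> A \<and>
     (\<forall>\<rho>. assignment A \<rho> \<longrightarrow> (\<forall>(l, r)\<in>E. eval_trm A \<rho> l = eval_trm A \<rho> r))"

text \<open>The value of a ground term does not depend on the assignment, and an assignment into
  \<open>A\<close> always exists.\<close>

definition sol_full :: "fsym set \<Rightarrow> trm \<Rightarrow> (trm \<times> trm) set \<Rightarrow> (nat \<Rightarrow> bool) set" where
  "sol_full \<Sigma> t E = {\<sigma>. \<exists>A \<rho>. full A \<and> model \<Sigma> E A \<and> assignment A \<rho> \<and>
     eval_trm A \<rho> t = StreamV \<sigma>}"


section \<open>The decision problems\<close>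

text \<open>An instance is coded by a number, so its signature has to be finite.\<close>

definition problem_instance :: "fsym set \<Rightarrow> (trm \<times> trm) set \<Rightarrow> trm \<Rightarrow> bool" where
  "problem_instance \<Sigma> E t \<longleftrightarrow>
     bitstream_signature \<Sigma> \<and> finite \<Sigma> \<and> bitstream_spec \<Sigma> E \<and>
     wf_trm \<Sigma> t \<and> ground t \<and> sort_of t = Stream"

fun code_srt :: "srt \<Rightarrow> nat" where
  "code_srt Bit = 0"
| "code_srt Stream = 1"

fun code_fsym :: "fsym \<Rightarrow> nat" where
  "code_fsym Zero = 0"
| "code_fsym One = 1"
| "code_fsym SCons = 2"
| "code_fsym (Fn k ss s) =
     3 + prod_encode (k, prod_encode (list_encode (map code_srt ss), code_srt s))"

fun code_trm :: "trm \<Rightarrow> nat" where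
  "code_trm (Var s x) = sum_encode (Inl (prod_encode (code_srt s, x)))"
| "code_trm (App f ts) =
     sum_encode (Inr (prod_encode (code_fsym f, list_encode (map code_trm ts))))"

fun code_eqn :: "trm \<times> trm \<Rightarrow> nat" where
  "code_eqn (l, r) = prod_encode (code_trm l, code_trm r)"

definition code_instance :: "fsym set \<Rightarrow> (trm \<times> trm) set \<Rightarrow> trm \<Rightarrow> nat" where
  "code_instance \<Sigma> E t =
     prod_encode (set_encode (code_fsym ` \<Sigma>),
       prod_encode (set_encode (code_eqn ` E), code_trm t))"

lemma code_srt_inject [simp]: "code_srt s = code_srt s' \<longleftrightarrow> s = s'"
  by (cases s; cases s') auto

lemma inj_code_srt: "inj code_srt"
  by (simp add: inj_def)

lemma code_fsym_inject [simp]: "code_fsym f = code_fsym g \<longleftrightarrow> f = g"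
  by (cases f; cases g) (auto simp: list_encode_eq inj_map_eq_map[OF inj_code_srt])

lemma code_trm_inject [simp]: "code_trm t = code_trm u \<longleftrightarrow> t = u"
proof
  show "code_trm t = code_trm u \<Longrightarrow> t = u"
  proof (induction t arbitrary: u)
    case (Var s x)
    then show ?case by (cases u) (auto simp: sum_encode_eq list_encode_eq)
  next
    case (App f ts)
    then obtain us where us: "u = App f us" "map code_trm ts = map code_trm us"
      by (cases u) (auto simp: sum_encode_eq list_encode_eq)
    have "ts = us"
    proof (rule nth_equalityI)
      show len: "length ts = length us"
        using us(2) by (rule map_eq_imp_length_eq)
      fix i assume i: "i < length ts"
      with us(2) len have "code_trm (ts ! i) = code_trm (us ! i)"
        by (metis nth_map)
      with App.IH i show "ts ! i = us ! i" by simp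
    qed
    with us(1) show ?case by simp
  qed
qed simp

lemma code_eqn_inject [simp]: "code_eqn p = code_eqn q \<longleftrightarrow> p = q"
  by (cases p; cases q) simp

lemma code_instance_inject:
  assumes "problem_instance \<Sigma> E t" and "problem_instance \<Sigma>' E' t'"
    and "code_instance \<Sigma> E t = code_instance \<Sigma>' E' t'"
  shows "\<Sigma> = \<Sigma>' \<and> E = E' \<and> t = t'"
proof -
  have fin: "finite \<Sigma>" "finite \<Sigma>'" "finite E" "finite E'"
    using assms(1,2) by (auto simp: problem_instance_def bitstream_spec_def)
  have "set_encode (code_fsym ` \<Sigma>) = set_encode (code_fsym ` \<Sigma>')"
    and "set_encode (code_eqn ` E) = set_encode (code_eqn ` E')" and "t = t'"
    using assms(3) by (auto simp: code_instance_def)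
  moreover have "inj code_fsym" "inj code_eqn"
    by (simp_all add: inj_def)
  ultimately show ?thesis
    using fin by (simp add: set_encode_eq inj_image_eq_iff)
qed

definition has_solution_problem :: "nat set" where
  "has_solution_problem =
     {code_instance \<Sigma> E t | \<Sigma> E t. problem_instance \<Sigma> E t \<and> sol_full \<Sigma> t E \<noteq> {}}"

definition unique_solution_problem :: "nat set" where
  "unique_solution_problem =
     {code_instance \<Sigma> E t | \<Sigma> E t. problem_instance \<Sigma> E t \<and> (\<exists>!\<sigma>. \<sigma> \<in> sol_full \<Sigma> t E)}"

definition at_most_one_solution_problem :: "nat set" where
  "at_most_one_solution_problem =
     {code_instance \<Sigma> E t | \<Sigma> E t. problem_instance \<Sigma> E t \<and>
        (\<forall>\<sigma>\<in>sol_full \<Sigma> t E. \<forall>\<tau>\<in>sol_full \<Sigma> t E. \<sigma> = \<tau>)}"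

end

(* Streams are read both as numbers (the position of the first 1) and as functions on numbers
   (the lengths of the successive blocks of zeros), by total surjective decodings; here the
   all-zero stream decodes to 0 and to the zero function.  Second-order quantifiers thus become
   quantifiers over streams, and a full model has all streams.  For every subformula there is a
   function symbol S^m -> B meant to give its truth value; Skolem functions turn the defining
   clauses into equations, which fix these symbols in every full model.  Adding the equation
   "the formula holds at x" gives a specification that has a full model iff the formula is true
   of x.  With a constant t forced to be 0^omega this settles existence and uniqueness of
   solutions.  With an unconstrained t and the negated formula, several solutions exist iff the
   original formula fails. *)

theory Submission
  imports Defs "HOL-Library.Countable"
begin


section \<open>Streams as numbers and as functions\<close>

type_synonym stream = "nat \<Rightarrow> bool"

abbreviation zeros :: stream where "zeros \<equiv> \<lambda>_. False"

text \<open>One rule per first bit, because the equations of the specification recurse on the first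
  bit too: rule induction then evaluates a symbol along its equations.\<close>

inductive represents :: "stream \<Rightarrow> nat \<Rightarrow> bool" where
  represents_One: "represents (case_nat True s) 0"
| represents_Zero: "represents s k \<Longrightarrow> represents (case_nat False s) (Suc k)"

lemma case_nat_eq_iff [simp]:
  "case_nat b s = case_nat c t \<longleftrightarrow> b = c \<and> s = (t :: stream)"
proof
  assume eq: "case_nat b s = case_nat c t"
  have "b = c" using fun_cong[OF eq, of 0] by simp
  moreover have "s n = t n" for n using fun_cong[OF eq, of "Suc n"] by simp
  ultimately show "b = c \<and> s = t" by auto
qed auto

lemma case_nat_zeros [simp]: "case_nat False zeros = zeros"
  by (rule ext) (simp split: nat.split)

lemma case_nat_True_neq_zeros [simp]: "case_nat True s \<noteq> zeros"
  by (auto dest: fun_cong[of _ _ 0])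

lemma case_nat_False_eq_zeros [simp]: "case_nat False s = zeros \<longleftrightarrow> s = zeros"
  using case_nat_eq_iff[of False s False zeros] by (simp del: case_nat_eq_iff)

lemma represents_case_nat_True [simp]: "represents (case_nat True s) k \<longleftrightarrow> k = 0"
  by (auto elim: represents.cases intro: represents.intros)

lemma represents_case_nat_False [simp]:
  "represents (case_nat False s) k \<longleftrightarrow> (\<exists>j. k = Suc j \<and> represents s j)"
  by (auto elim: represents.cases intro: represents.intros)

lemma represents_iff: "represents s k \<longleftrightarrow> s k \<and> (\<forall>i<k. \<not> s i)"
proof
  show "represents s k \<Longrightarrow> s k \<and> (\<forall>i<k. \<not> s i)"
    by (induction rule: represents.induct) (auto split: nat.split)
  show "s k \<and> (\<forall>i<k. \<not> s i) \<Longrightarrow> represents s k"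
  proof (induction k arbitrary: s)
    case 0
    then have "s = case_nat True (\<lambda>i. s (Suc i))" by (auto simp: fun_eq_iff split: nat.split)
    then show ?case by (metis represents_One)
  next
    case (Suc k)
    then have "s = case_nat False (\<lambda>i. s (Suc i))" by (auto simp: fun_eq_iff split: nat.split)
    moreover have "represents (\<lambda>i. s (Suc i)) k" using Suc by auto
    ultimately show ?case by (metis represents_Zero)
  qed
qed

lemma represents_unique: "represents s k \<Longrightarrow> represents s j \<Longrightarrow> j = k"
  by (metis represents_iff nat_neq_iff)

lemma not_represents_zeros [simp]: "\<not> represents zeros k"
  by (simp add: represents_iff)

lemma ex_represents_iff: "(\<exists>k. represents s k) \<longleftrightarrow> s \<noteq> zeros"
proof
  assume "s \<noteq> zeros"
  then obtain n where "s n" by auto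
  then show "\<exists>k. represents s k"
    unfolding represents_iff by (metis LeastI not_less_Least)
qed auto

definition num :: "stream \<Rightarrow> nat" where
  "num s = (if s = zeros then 0 else THE k. represents s k)"

lemma num_eqI: "represents s k \<Longrightarrow> num s = k"
  by (auto simp: num_def dest: represents_unique)

lemma num_zeros [simp]: "num zeros = 0"
  by (simp add: num_def)

section \<open>Lengths of the successive blocks of zeros\<close>

definition drop_block :: "stream \<Rightarrow> stream" where
  "drop_block s = (\<lambda>i. s (i + Suc (num s)))"

lemma drop_block_zeros [simp]: "drop_block zeros = zeros"
  by (simp add: drop_block_def)

lemma drop_block_True [simp]: "drop_block (case_nat True s) = s"
  by (simp add: drop_block_def num_eqI)

text \<open>A leading 0 raises \<open>num s\<close> by one and the larger shift absorbs it; for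
  \<open>s = zeros\<close> both sides are \<open>zeros\<close>.\<close>

lemma drop_block_False [simp]: "drop_block (case_nat False s) = drop_block s"
proof (cases "s = zeros")
  case False
  then obtain k where "represents s k" using ex_represents_iff by blast
  then have "num s = k" "num (case_nat False s) = Suc k" by (auto intro: num_eqI)
  then show ?thesis by (simp add: drop_block_def)
qed simp

definition blocks :: "stream \<Rightarrow> nat \<Rightarrow> nat" where
  "blocks s k = num ((drop_block ^^ k) s)"

lemma blocks_zeros [simp]: "blocks zeros = (\<lambda>_. 0)"
proof
  fix k
  have "(drop_block ^^ k) zeros = zeros" by (induction k) auto
  then show "blocks zeros k = 0" by (simp add: blocks_def)
qed

fun numeral_stream :: "nat \<Rightarrow> stream" where
  "numeral_stream 0 = case_nat True zeros"
| "numeral_stream (Suc k) = case_nat False (numeral_stream k)"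

lemma represents_numeral_stream: "represents (numeral_stream k) k"
  by (induction k) auto

lemma num_numeral_stream [simp]: "num (numeral_stream k) = k"
  by (rule num_eqI[OF represents_numeral_stream])

lemma blocks_surj: "\<exists>s. blocks s = g"
proof -
  \<comment> \<open>\<open>p k\<close> is the start of block \<open>k\<close>: each earlier block
    \<open>j\<close> takes \<open>g j\<close> zeros and one closing 1.\<close>
  define p where "p k = (\<Sum>j<k. Suc (g j))" for k
  define s :: stream where "s i \<longleftrightarrow> (\<exists>k. i = p k + g k)" for i
  have p_Suc: "p (Suc k) = Suc (p k + g k)" for k by (simp add: p_def)
  have mono: "strict_mono p" by (simp add: strict_mono_Suc_iff p_Suc)
  have rep: "represents (\<lambda>i. s (i + p k)) (g k)" for k
    unfolding represents_iff
  proof (intro conjI allI impI notI)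
    show "s (g k + p k)" unfolding s_def by (metis add.commute)
    fix i assume "i < g k" "s (i + p k)"
    then obtain l where l: "i + p k = p l + g l" by (auto simp: s_def)
    \<comment> \<open>The closing 1 of block \<open>l\<close> precedes \<open>p k\<close> if
      \<open>l < k\<close>, and comes after the end of block \<open>k\<close> if
      \<open>k < l\<close>.\<close>
    consider "l < k" | "l = k" | "k < l" by linarith
    then show False
    proof cases
      case 1
      then have "p (Suc l) \<le> p k" using mono by (simp add: strict_mono_less_eq)
      with l show False by (simp add: p_Suc)
    next
      case 2
      with l \<open>i < g k\<close> show False by simp
    next
      case 3
      then have "p (Suc k) \<le> p l" using mono by (simp add: strict_mono_less_eq)
      with l \<open>i < g k\<close> show False by (simp add: p_Suc)
    qed
  qed
  have "(drop_block ^^ k) s = (\<lambda>i. s (i + p k))" for k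
  proof (induction k)
    case 0
    show ?case by (simp add: p_def)
  next
    case (Suc k)
    have "num (\<lambda>i. s (i + p k)) = g k" using rep by (rule num_eqI)
    with Suc show ?case
      by (simp add: drop_block_def p_Suc algebra_simps)
  qed
  with rep have "blocks s k = g k" for k
    by (simp add: blocks_def num_eqI)
  then show ?thesis by blast
qed


section \<open>Formulas over streams\<close>

text \<open>Nand and one existential quantifier suffice, which keeps the kinds of defining clauses
  few; quantifiers over numbers and over functions both become \<open>SEx\<close>.\<close>

datatype sform = SEq aterm aterm | SNand sform sform | SEx nat sform

text \<open>Stream variable \<open>2 * x\<close> stands for the number variable \<open>x\<close>, and \<open>2 * F + 1\<close> for the
  function variable \<open>F\<close>.\<close>

definition aval :: "(nat \<Rightarrow> stream) \<Rightarrow> aterm \<Rightarrow> nat" where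
  "aval r = aeval (\<lambda>x. num (r (2 * x))) (\<lambda>F. blocks (r (2 * F + 1)))"

primrec ssat :: "(nat \<Rightarrow> stream) \<Rightarrow> sform \<Rightarrow> bool" where
  "ssat r (SEq a b) \<longleftrightarrow> aval r a = aval r b"
| "ssat r (SNand p q) \<longleftrightarrow> \<not> (ssat r p \<and> ssat r q)"
| "ssat r (SEx j p) \<longleftrightarrow> (\<exists>s. ssat (r(j := s)) p)"

abbreviation SNeg :: "sform \<Rightarrow> sform" where
  "SNeg p \<equiv> SNand p p"

primrec sform_of :: "aform \<Rightarrow> sform" where
  "sform_of (AEq a b) = SEq a b"
| "sform_of (ANeg p) = SNeg (sform_of p)"
| "sform_of (AAnd p q) = SNeg (SNand (sform_of p) (sform_of q))"
| "sform_of (AOr p q) = SNand (SNeg (sform_of p)) (SNeg (sform_of q))"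
| "sform_of (AllN x p) = SNeg (SEx (2 * x) (SNeg (sform_of p)))"
| "sform_of (ExN x p) = SEx (2 * x) (sform_of p)"
| "sform_of (AllF F p) = SNeg (SEx (2 * F + 1) (SNeg (sform_of p)))"
| "sform_of (ExF F p) = SEx (2 * F + 1) (sform_of p)"

lemma num_upd:
  "(\<lambda>y. num ((r(2 * x := s)) (2 * y))) = (\<lambda>y. num (r (2 * y)))(x := num s)"
  "(\<lambda>y. num ((r(Suc (2 * x) := s)) (2 * y))) = (\<lambda>y. num (r (2 * y)))"
  by (auto simp: fun_eq_iff) presburger+

lemma blocks_upd:
  "(\<lambda>G. blocks ((r(Suc (2 * F) := s)) (Suc (2 * G)))) = (\<lambda>G. blocks (r (Suc (2 * G))))(F := blocks s)"
  "(\<lambda>G. blocks ((r(2 * F := s)) (Suc (2 * G)))) = (\<lambda>G. blocks (r (Suc (2 * G))))"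
  by (auto simp: fun_eq_iff) presburger+

lemma ex_num_iff: "(\<exists>s. P (num s)) \<longleftrightarrow> (\<exists>k. P k)"
  by (metis num_numeral_stream)

lemma ex_blocks_iff: "(\<exists>s. P (blocks s)) \<longleftrightarrow> (\<exists>g. P g)"
  by (metis blocks_surj)

text \<open>\<open>num\<close> and \<open>blocks\<close> are surjective, so quantifying over streams
  covers all numbers and all functions. Even and odd indices keep the two decoded environments
  independent.\<close>

lemma ssat_sform_of:
  "ssat r (sform_of p) \<longleftrightarrow> asat (\<lambda>x. num (r (2 * x))) (\<lambda>F. blocks (r (2 * F + 1))) p"
proof (induction p arbitrary: r)
  case (AllN x p)
  show ?case
    using ex_num_iff[of "\<lambda>k. \<not> asat ((\<lambda>x. num (r (2 * x)))(x := k)) (\<lambda>F. blocks (r (2 * F + 1))) p"]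
    by (simp add: AllN num_upd blocks_upd del: fun_upd_apply)
next
  case (ExN x p)
  show ?case
    using ex_num_iff[of "\<lambda>k. asat ((\<lambda>x. num (r (2 * x)))(x := k)) (\<lambda>F. blocks (r (2 * F + 1))) p"]
    by (simp add: ExN num_upd blocks_upd del: fun_upd_apply)
next
  case (AllF F p)
  show ?case
    using ex_blocks_iff[of "\<lambda>g. \<not> asat (\<lambda>x. num (r (2 * x))) ((\<lambda>F. blocks (r (2 * F + 1)))(F := g)) p"]
    by (simp add: AllF num_upd blocks_upd del: fun_upd_apply)
next
  case (ExF F p)
  show ?case
    using ex_blocks_iff[of "\<lambda>g. asat (\<lambda>x. num (r (2 * x))) ((\<lambda>F. blocks (r (2 * F + 1)))(F := g)) p"]
    by (simp add: ExF num_upd blocks_upd del: fun_upd_apply)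
qed (auto simp: aval_def)

section \<open>Bounds on the variables of a formula\<close>

text \<open>The truth symbols of all subformulas share the arity \<open>m\<close>, so every
  variable, bound ones included, must be an argument position below \<open>m\<close>.\<close>

primrec bounded :: "nat \<Rightarrow> sform \<Rightarrow> bool" where
  "bounded m (SEq a b) \<longleftrightarrow> (\<forall>x\<in>nvars a \<union> nvars b. 2 * x < m) \<and> (\<forall>F\<in>fvars a \<union> fvars b. 2 * F + 1 < m)"
| "bounded m (SNand p q) \<longleftrightarrow> bounded m p \<and> bounded m q"
| "bounded m (SEx j p) \<longleftrightarrow> j < m \<and> bounded m p"

lemma finite_nvars [simp]: "finite (nvars a)"
  by (induction a) auto

lemma finite_fvars [simp]: "finite (fvars a)"
  by (induction a) auto

lemma eventually_bounded: "\<exists>n. \<forall>m\<ge>n. bounded m p"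
proof (induction p)
  case (SEq a b)
  define V where "V = (\<lambda>x. 2 * x) ` (nvars a \<union> nvars b) \<union> (\<lambda>F. 2 * F + 1) ` (fvars a \<union> fvars b)"
  have "finite V" by (simp add: V_def)
  then obtain n where "\<forall>v\<in>V. v < n" by (meson finite_nat_set_iff_bounded)
  then have "\<forall>v\<in>V. v < m" if "n \<le> m" for m
    using that by (meson order_less_le_trans)
  then have "\<forall>m\<ge>n. bounded m (SEq a b)"
    by (simp add: V_def ball_Un)
  then show ?case by blast
next
  case (SNand p q)
  then obtain n k where "\<forall>m\<ge>n. bounded m p" "\<forall>m\<ge>k. bounded m q" by blast
  then have "\<forall>m\<ge>max n k. bounded m (SNand p q)" by simp
  then show ?case by blast
next
  case (SEx j p)
  then obtain n where "\<forall>m\<ge>n. bounded m p" by blast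
  then have "\<forall>m\<ge>max n (Suc j). bounded m (SEx j p)" by simp
  then show ?case by blast
qed

lemma aval_cong:
  assumes "\<And>x. x \<in> nvars a \<Longrightarrow> r (2 * x) = r' (2 * x)"
    and "\<And>F. F \<in> fvars a \<Longrightarrow> r (2 * F + 1) = r' (2 * F + 1)"
  shows "aval r a = aval r' a"
  using assms unfolding aval_def by (induction a) auto

text \<open>Countability lets formulas serve as names of function symbols: \<open>to_nat\<close>
  supplies the number in \<open>Fn\<close> and keeps different formulas apart.\<close>

instance aterm :: countable by countable_datatype
instance sform :: countable by countable_datatype


section \<open>The specification\<close>

datatype opr =
    OZeros
  | OFree
  | ONand
  | OEx
  | OFix
  | OAdd
  | OMul
  | ODrop
  | OApp
  | OEq
  | OHolds nat sform
  | OSk nat nat sform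

instance opr :: countable by countable_datatype

fun opr_args :: "opr \<Rightarrow> srt list" where
  "opr_args OZeros = []"
| "opr_args OFree = []"
| "opr_args ONand = [Bit, Bit]"
| "opr_args OEx = [Stream]"
| "opr_args OFix = [Bit, Stream]"
| "opr_args OAdd = [Stream, Stream]"
| "opr_args OMul = [Stream, Stream]"
| "opr_args ODrop = [Stream]"
| "opr_args OApp = [Stream, Stream]"
| "opr_args OEq = [Stream, Stream]"
| "opr_args (OHolds m p) = replicate m Stream"
| "opr_args (OSk m j p) = replicate m Stream"

fun opr_res :: "opr \<Rightarrow> srt" where
  "opr_res ONand = Bit"
| "opr_res OEx = Bit"
| "opr_res OEq = Bit"
| "opr_res (OHolds m p) = Bit"
| "opr_res _ = Stream"

definition op_sym :: "opr \<Rightarrow> fsym" where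
  "op_sym f = Fn (to_nat f) (opr_args f) (opr_res f)"

lemma op_sym_eq_iff [simp]: "op_sym f = op_sym g \<longleftrightarrow> f = g"
  by (auto simp: op_sym_def)

lemma op_sym_simps [simp]:
  "op_sym f \<noteq> Zero" "op_sym f \<noteq> One" "op_sym f \<noteq> SCons"
  "arg_sorts (op_sym f) = opr_args f" "res_sort (op_sym f) = opr_res f"
  by (simp_all add: op_sym_def)

abbreviation ap :: "opr \<Rightarrow> trm list \<Rightarrow> trm" where
  "ap f ts \<equiv> App (op_sym f) ts"

abbreviation zeroT :: trm where "zeroT \<equiv> App Zero []"
abbreviation oneT :: trm where "oneT \<equiv> App One []"
abbreviation consT :: "trm \<Rightarrow> trm \<Rightarrow> trm" where "consT b s \<equiv> App SCons [b, s]"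
abbreviation zerosT :: trm where "zerosT \<equiv> ap OZeros []"

text \<open>\<open>OEx\<close> and \<open>ODrop\<close> have separate equations at
  \<open>zeros\<close>, where the recursion only equates a value with itself. \<open>OFix\<close>
  returns its second argument or a representation of 0, depending on a bit. \<open>OFree\<close>
  occurs in no equation, so its value is arbitrary.\<close>

definition base_eqs :: "(trm \<times> trm) set" where
  "base_eqs = (let b = Var Bit 0; s = Var Stream 0; t = Var Stream 1 in
    {(zerosT, consT zeroT zerosT),
     (ap ONand [zeroT, b], oneT),
     (ap ONand [oneT, zeroT], oneT),
     (ap ONand [oneT, oneT], zeroT),
     (ap OEx [consT oneT s], oneT),
     (ap OEx [consT zeroT s], ap OEx [s]),
     (ap OEx [zerosT], zeroT),
     (ap OFix [oneT, s], s),
     (ap OFix [zeroT, s], consT oneT zerosT),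
     (ap OAdd [consT oneT s, t], t),
     (ap OAdd [consT zeroT s, t], consT zeroT (ap OAdd [s, t])),
     (ap OMul [consT oneT s, t], consT oneT zerosT),
     (ap OMul [consT zeroT s, t], ap OAdd [t, ap OMul [s, t]]),
     (ap ODrop [consT oneT s], s),
     (ap ODrop [consT zeroT s], ap ODrop [s]),
     (ap ODrop [zerosT], zerosT),
     (ap OApp [consT oneT s, t], t),
     (ap OApp [consT zeroT s, t], ap ODrop [ap OApp [s, t]]),
     (ap OEq [consT oneT s, consT oneT t], oneT),
     (ap OEq [consT oneT s, consT zeroT t], zeroT),
     (ap OEq [consT zeroT s, consT oneT t], zeroT),
     (ap OEq [consT zeroT s, consT zeroT t], ap OEq [s, t])})"

definition base_syms :: "fsym set" where
  "base_syms = {Zero, One, SCons} \<union>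
     op_sym ` {OZeros, OFree, ONand, OEx, OFix, OAdd, OMul, ODrop, OApp, OEq}"

text \<open>Replaces the all-zero stream by a proper representation of \<open>0\<close>: the equations of \<open>OAdd\<close>,
  \<open>OMul\<close>, \<open>OApp\<close> and \<open>OEq\<close> determine values only on streams that contain a 1.\<close>

abbreviation normT :: "trm \<Rightarrow> trm" where
  "normT t \<equiv> ap OFix [ap OEx [t], t]"

primrec trm_of :: "aterm \<Rightarrow> trm" where
  "trm_of (NVar x) = normT (Var Stream (2 * x))"
| "trm_of NZero = consT oneT zerosT"
| "trm_of (NSuc a) = consT zeroT (trm_of a)"
| "trm_of (NAdd a b) = ap OAdd [trm_of a, trm_of b]"
| "trm_of (NMul a b) = ap OMul [trm_of a, trm_of b]"
| "trm_of (FApp F a) = normT (ap OApp [trm_of a, Var Stream (2 * F + 1)])"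

definition vars :: "nat \<Rightarrow> trm list" where
  "vars m = map (Var Stream) [0..<m]"

abbreviation holdsT :: "nat \<Rightarrow> sform \<Rightarrow> trm list \<Rightarrow> trm" where
  "holdsT m p ts \<equiv> ap (OHolds m p) ts"

text \<open>In the clause for \<open>SEx\<close>, \<open>OSk m j p\<close> is a Skolem function for coordinate \<open>j\<close>, and the variable
  \<open>m\<close>, which does not occur in \<open>vars m\<close>, ranges over all candidate witnesses.\<close>

primrec form_eqs :: "nat \<Rightarrow> sform \<Rightarrow> (trm \<times> trm) set" where
  "form_eqs m (SEq a b) = {(holdsT m (SEq a b) (vars m), ap OEq [trm_of a, trm_of b])}"
| "form_eqs m (SNand p q) =
     {(holdsT m (SNand p q) (vars m), ap ONand [holdsT m p (vars m), holdsT m q (vars m)])}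
     \<union> form_eqs m p \<union> form_eqs m q"
| "form_eqs m (SEx j p) =
     {(holdsT m (SEx j p) (vars m), holdsT m p ((vars m)[j := ap (OSk m j p) (vars m)])),
      (ap ONand [holdsT m p ((vars m)[j := Var Stream m]),
         ap ONand [holdsT m (SEx j p) (vars m), holdsT m (SEx j p) (vars m)]], oneT)}
     \<union> form_eqs m p"

primrec form_syms :: "nat \<Rightarrow> sform \<Rightarrow> fsym set" where
  "form_syms m (SEq a b) = {op_sym (OHolds m (SEq a b))}"
| "form_syms m (SNand p q) = {op_sym (OHolds m (SNand p q))} \<union> form_syms m p \<union> form_syms m q"
| "form_syms m (SEx j p) = {op_sym (OHolds m (SEx j p)), op_sym (OSk m j p)} \<union> form_syms m p"

fun numT :: "nat \<Rightarrow> trm" where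
  "numT 0 = consT oneT zerosT"
| "numT (Suc k) = consT zeroT (numT k)"

text \<open>Coordinate 0 belongs to number variable 0, the input; \<open>zeros\<close> elsewhere
  decodes to 0 and to the zero function, the defaults of \<open>defined_set\<close>.\<close>

definition query :: "nat \<Rightarrow> sform \<Rightarrow> nat \<Rightarrow> trm \<times> trm" where
  "query m p x = (holdsT m p (numT x # replicate (m - 1) zerosT), oneT)"

abbreviation spec_syms :: "nat \<Rightarrow> sform \<Rightarrow> fsym set" where
  "spec_syms m p \<equiv> base_syms \<union> form_syms m p"

abbreviation spec_eqs :: "nat \<Rightarrow> sform \<Rightarrow> nat \<Rightarrow> (trm \<times> trm) set" where
  "spec_eqs m p x \<equiv> insert (query m p x) (base_eqs \<union> form_eqs m p)"


subsection \<open>Well-formedness\<close>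

lemma finite_form_syms [simp]: "finite (form_syms m p)"
  by (induction p) auto

lemma finite_form_eqs [simp]: "finite (form_eqs m p)"
  by (induction p) auto

lemma finite_base [simp]: "finite base_syms" "finite base_eqs"
  by (simp_all add: base_syms_def base_eqs_def Let_def)

lemma base_symsI [simp]:
  "Zero \<in> base_syms" "One \<in> base_syms" "SCons \<in> base_syms"
  "op_sym OZeros \<in> base_syms" "op_sym OFree \<in> base_syms" "op_sym ONand \<in> base_syms" "op_sym OEx \<in> base_syms"
  "op_sym OFix \<in> base_syms" "op_sym OAdd \<in> base_syms" "op_sym OMul \<in> base_syms" "op_sym ODrop \<in> base_syms"
  "op_sym OApp \<in> base_syms" "op_sym OEq \<in> base_syms"
  by (auto simp: base_syms_def)

lemma op_sym_OHolds_in_form_syms [simp]: "op_sym (OHolds m p) \<in> form_syms m p"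
  by (cases p) auto

definition wf_eqn :: "fsym set \<Rightarrow> trm \<times> trm \<Rightarrow> bool" where
  "wf_eqn S = (\<lambda>(l, r). wf_trm S l \<and> wf_trm S r \<and> sort_of l = sort_of r)"

lemma wf_base_eqs: "base_syms \<subseteq> S \<Longrightarrow> e \<in> base_eqs \<Longrightarrow> wf_eqn S e"
  using base_symsI by (auto simp: wf_eqn_def base_eqs_def Let_def subset_iff)

lemma wf_trm_of: "base_syms \<subseteq> S \<Longrightarrow> wf_trm S (trm_of a) \<and> sort_of (trm_of a) = Stream"
  using base_symsI by (induction a) (auto simp: subset_iff)

lemma wf_numT: "base_syms \<subseteq> S \<Longrightarrow> wf_trm S (numT k) \<and> sort_of (numT k) = Stream"
  using base_symsI by (induction k) (auto simp: subset_iff)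

lemma length_vars [simp]: "length (vars m) = m"
  by (simp add: vars_def)

lemma sorts_vars [simp]: "map sort_of (vars m) = replicate m Stream"
  by (rule nth_equalityI) (auto simp: vars_def)

lemma sorts_vars_update [simp]:
  "sort_of t = Stream \<Longrightarrow> map sort_of ((vars m)[j := t]) = replicate m Stream"
  by (simp add: map_update) (metis list_update_id nth_replicate list_update_beyond length_replicate not_le)

lemma wf_vars [simp]: "t \<in> set (vars m) \<Longrightarrow> wf_trm S t"
  by (auto simp: vars_def)

lemma wf_vars_update:
  "t \<in> set ((vars m)[j := u]) \<Longrightarrow> wf_trm S u \<Longrightarrow> wf_trm S t"
  using set_update_subset_insert[of "vars m" j u] by (auto dest: wf_vars)

lemma wf_form_eqs:
  "base_syms \<subseteq> S \<Longrightarrow> form_syms m p \<subseteq> S \<Longrightarrow> e \<in> form_eqs m p \<Longrightarrow> wf_eqn S e"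
proof (induction p)
  case (SEq a b)
  then show ?case using base_symsI wf_trm_of[of S]
    by (auto simp: wf_eqn_def subset_iff)
next
  case (SNand p q)
  then show ?case using base_symsI op_sym_OHolds_in_form_syms[of m p] op_sym_OHolds_in_form_syms[of m q]
    by (auto simp: wf_eqn_def subset_iff)
next
  case (SEx j p)
  then have "op_sym (OSk m j p) \<in> S" by simp
  with SEx show ?case using base_symsI op_sym_OHolds_in_form_syms[of m p]
    by (auto simp: wf_eqn_def subset_iff dest!: wf_vars_update)
qed

lemma wf_query: "0 < m \<Longrightarrow> wf_eqn (spec_syms m p) (query m p x)"
  using wf_numT[of "spec_syms m p" x]
  by (cases m) (auto simp: wf_eqn_def query_def)

lemma problem_instance_spec:
  assumes "0 < m" and "f = OZeros \<or> f = OFree"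
  shows "problem_instance (spec_syms m p) (spec_eqs m p x) (ap f [])"
proof -
  have "wf_eqn (spec_syms m p) e" if "e \<in> spec_eqs m p x" for e
    using that wf_query[OF assms(1)] wf_base_eqs[of "spec_syms m p" e]
      wf_form_eqs[of "spec_syms m p" m p e] by auto
  then show ?thesis
    using assms(2)
    by (auto simp: problem_instance_def bitstream_signature_def bitstream_spec_def wf_eqn_def)
qed

text \<open>Separates the clauses from the query, whose sides are ground: \<open>0 < m\<close> puts
  a variable into the left side of each clause.\<close>

lemma nonground_form_eqs: "0 < m \<Longrightarrow> (l, r) \<in> form_eqs m p \<Longrightarrow> \<not> ground l"
proof (induction p)
  case (SEx j p)
  have "\<not> (\<forall>t\<in>set (vars m). ground t)" using SEx.prems by (force simp: vars_def)
  with SEx show ?case by auto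
qed (force simp: vars_def)+

lemma ground_numT [simp]: "ground (numT x)"
  by (induction x) auto

lemma query_notin:
  assumes "0 < m"
  shows "query m p x \<notin> base_eqs \<union> form_eqs m p"
proof -
  have "ground (fst (query m p x))" by (simp add: query_def)
  then have "query m p x \<notin> form_eqs m p"
    using nonground_form_eqs[OF assms] by (metis prod.collapse)
  moreover have "query m p x \<notin> base_eqs"
    by (simp add: query_def base_eqs_def Let_def)
  ultimately show ?thesis by simp
qed


section \<open>Full models of the specification\<close>

definition asg :: "(nat \<Rightarrow> bool) \<Rightarrow> (nat \<Rightarrow> stream) \<Rightarrow> srt \<Rightarrow> nat \<Rightarrow> val" where
  "asg b r s x = (case s of Bit \<Rightarrow> BitV (b x) | Stream \<Rightarrow> StreamV (r x))"

lemma asg_simps [simp]: "asg b r Bit x = BitV (b x)" "asg b r Stream x = StreamV (r x)"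
  by (simp_all add: asg_def)

definition satisfies :: "alg \<Rightarrow> trm \<times> trm \<Rightarrow> bool" where
  "satisfies A e \<longleftrightarrow> (\<forall>b r. eval_trm A (asg b r) (fst e) = eval_trm A (asg b r) (snd e))"

text \<open>Allows evaluation in full algebras to range over pairs \<open>b\<close>,
  \<open>r\<close> without carrier conditions.\<close>

lemma assignment_full_iff:
  assumes "full A"
  shows "assignment A \<rho> \<longleftrightarrow> (\<exists>b r. \<rho> = asg b r)"
proof
  assume "assignment A \<rho>"
  then have carrier: "\<rho> s x \<in> carrier_of A s" for s x
    by (simp add: assignment_def)
  have "\<forall>x. \<exists>b. \<rho> Bit x = BitV b"
    using carrier[of Bit] by auto
  then obtain b where b: "\<And>x. \<rho> Bit x = BitV (b x)" by metis
  have "\<forall>x. \<exists>r. \<rho> Stream x = StreamV r"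
    using carrier[of Stream] by auto
  then obtain r where r: "\<And>x. \<rho> Stream x = StreamV (r x)" by metis
  have "\<rho> s x = asg b r s x" for s x
    by (cases s) (simp_all add: b r)
  then show "\<exists>b r. \<rho> = asg b r" by blast
next
  assume "\<exists>b r. \<rho> = asg b r"
  moreover have "asg b r s x \<in> carrier_of A s" for b r s x
    using assms by (cases s) (auto simp: full_def)
  ultimately show "assignment A \<rho>"
    by (auto simp: assignment_def)
qed

lemma model_full_iff:
  "full A \<Longrightarrow> model S E A \<longleftrightarrow> stream_algebra S A \<and> (\<forall>e\<in>E. satisfies A e)"
  by (fastforce simp: model_def satisfies_def assignment_full_iff)

text \<open>Bits after the first 1 are arbitrary, so arithmetic is tracked up to the represented
  number and not by the exact stream.\<close>

definition is_num :: "val \<Rightarrow> nat \<Rightarrow> bool" where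
  "is_num v k \<longleftrightarrow> (\<exists>s. v = StreamV s \<and> represents s k)"

definition env :: "nat \<Rightarrow> (nat \<Rightarrow> stream) \<Rightarrow> val list" where
  "env m r = map (\<lambda>i. StreamV (r i)) [0..<m]"

lemma env_update: "(env m r)[j := StreamV s] = env m (r(j := s))"
  by (rule nth_equalityI) (auto simp: env_def nth_list_update)

lemma env_upd_beyond: "env m (r(m := s)) = env m r"
  by (rule nth_equalityI) (auto simp: env_def)

lemma eval_vars [simp]: "map (eval_trm A (asg b r)) (vars m) = env m r"
  by (simp add: vars_def env_def)

lemma eval_vars_update [simp]:
  "map (eval_trm A (asg b r)) ((vars m)[j := t]) = (env m r)[j := eval_trm A (asg b r) t]"
  by (simp add: map_update)

section \<open>Values forced by the equations\<close>

text \<open>Weak enough to cover arbitrary full models of the specification as well as the standard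
  model before its formula equations are verified.\<close>

locale base_model =
  fixes A :: alg
  assumes Zero [simp]: "interp A Zero [] = BitV False"
    and One [simp]: "interp A One [] = BitV True"
    and SCons [simp]: "interp A SCons [BitV b, StreamV s] = StreamV (case_nat b s)"
    and zeros_stream: "\<exists>z. interp A (op_sym OZeros) [] = StreamV z"
    and base: "e \<in> base_eqs \<Longrightarrow> satisfies A e"
begin

abbreviation I :: "opr \<Rightarrow> val list \<Rightarrow> val" where
  "I f \<equiv> interp A (op_sym f)"

lemma I_OZeros [simp]: "I OZeros [] = StreamV zeros"
proof -
  obtain z where z: "I OZeros [] = StreamV z" using zeros_stream by blast
  have "satisfies A (zerosT, consT zeroT zerosT)"
    by (rule base) (simp add: base_eqs_def Let_def)
  then have "z = case_nat False z"
    by (simp add: satisfies_def z)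
  then have eq: "z i = case_nat False z i" for i by metis
  \<comment> \<open>The equation \<open>z = 0:z\<close> determines \<open>z\<close> bit by
    bit.\<close>
  have "\<not> z i" for i
  proof (induction i)
    case 0
    show ?case using eq[of 0] by simp
  next
    case (Suc i)
    then show ?case using eq[of "Suc i"] by simp
  qed
  then show ?thesis by (simp add: z fun_eq_iff)
qed

lemma base_instance:
  "\<forall>e\<in>base_eqs. eval_trm A (asg (\<lambda>_. b) (\<lambda>i. if i = 0 then s else t)) (fst e)
    = eval_trm A (asg (\<lambda>_. b) (\<lambda>i. if i = 0 then s else t)) (snd e)"
  using base by (simp add: satisfies_def)

text \<open>In the recursion for \<open>OAdd\<close> the constructor stays unevaluated, because the
  value under it is not yet known to be a stream.\<close>

lemma equations:
  shows "I ONand [BitV False, BitV b] = BitV True"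
    and "I ONand [BitV True, BitV False] = BitV True"
    and "I ONand [BitV True, BitV True] = BitV False"
    and "I OEx [StreamV (case_nat True s)] = BitV True"
    and "I OEx [StreamV (case_nat False s)] = I OEx [StreamV s]"
    and "I OEx [StreamV zeros] = BitV False"
    and "I OFix [BitV True, StreamV s] = StreamV s"
    and "I OFix [BitV False, StreamV s] = StreamV (case_nat True zeros)"
    and "I OAdd [StreamV (case_nat True s), StreamV t] = StreamV t"
    and "I OAdd [StreamV (case_nat False s), StreamV t]
      = interp A SCons [BitV False, I OAdd [StreamV s, StreamV t]]"
    and "I OMul [StreamV (case_nat True s), StreamV t] = StreamV (case_nat True zeros)"
    and "I OMul [StreamV (case_nat False s), StreamV t]
      = I OAdd [StreamV t, I OMul [StreamV s, StreamV t]]"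
    and "I ODrop [StreamV (case_nat True s)] = StreamV s"
    and "I ODrop [StreamV (case_nat False s)] = I ODrop [StreamV s]"
    and "I ODrop [StreamV zeros] = StreamV zeros"
    and "I OApp [StreamV (case_nat True s), StreamV t] = StreamV t"
    and "I OApp [StreamV (case_nat False s), StreamV t] = I ODrop [I OApp [StreamV s, StreamV t]]"
    and "I OEq [StreamV (case_nat True s), StreamV (case_nat True t)] = BitV True"
    and "I OEq [StreamV (case_nat True s), StreamV (case_nat False t)] = BitV False"
    and "I OEq [StreamV (case_nat False s), StreamV (case_nat True t)] = BitV False"
    and "I OEq [StreamV (case_nat False s), StreamV (case_nat False t)] = I OEq [StreamV s, StreamV t]"
  using base_instance[of b s t, unfolded base_eqs_def Let_def, simplified] by argo+

lemma I_ONand [simp]: "I ONand [BitV b, BitV c] = BitV (\<not> (b \<and> c))"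
  by (cases b; cases c) (simp_all add: equations)

lemma I_OEx: "I OEx [StreamV s] = BitV (s \<noteq> zeros)"
proof (cases "s = zeros")
  case False
  then obtain k where "represents s k" using ex_represents_iff by blast
  then have "I OEx [StreamV s] = BitV True"
    by (induction rule: represents.induct) (simp_all add: equations)
  with False show ?thesis by simp
qed (simp add: equations)

lemma norm_num: "is_num (I OFix [I OEx [StreamV s], StreamV s]) (num s)"
proof (cases "s = zeros")
  case True
  then show ?thesis by (simp add: I_OEx equations is_num_def)
next
  case False
  then obtain k where "represents s k" using ex_represents_iff by blast
  with False show ?thesis by (auto simp: I_OEx equations is_num_def dest: num_eqI)
qed

lemma is_num_Suc: "is_num v k \<Longrightarrow> is_num (interp A SCons [BitV False, v]) (Suc k)"
  by (auto simp: is_num_def)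

lemma is_num_add:
  assumes "is_num v k" "is_num w l"
  shows "is_num (I OAdd [v, w]) (k + l)"
proof -
  obtain s t where st: "v = StreamV s" "represents s k" "w = StreamV t" "represents t l"
    using assms by (auto simp: is_num_def)
  from st(2) have "is_num (I OAdd [StreamV s, StreamV t]) (k + l)"
    by (induction rule: represents.induct)
      (use assms(2) st(3) in \<open>simp_all add: equations is_num_Suc\<close>)
  with st show ?thesis by simp
qed

lemma is_num_mul:
  assumes "is_num v k" "is_num w l"
  shows "is_num (I OMul [v, w]) (k * l)"
proof -
  obtain s t where st: "v = StreamV s" "represents s k" "w = StreamV t" "represents t l"
    using assms by (auto simp: is_num_def)
  from st(2) have "is_num (I OMul [StreamV s, StreamV t]) (k * l)"
  proof (induction rule: represents.induct)
    case (represents_One s)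
    then show ?case by (simp add: equations is_num_def)
  next
    case (represents_Zero s k)
    then show ?case using assms(2) st(3) by (simp add: equations is_num_add)
  qed
  with st show ?thesis by simp
qed

lemma I_ODrop: "I ODrop [StreamV s] = StreamV (drop_block s)"
proof (cases "s = zeros")
  case False
  then obtain k where "represents s k" using ex_represents_iff by blast
  then show ?thesis
    by (induction rule: represents.induct) (simp_all add: equations)
qed (simp add: equations)

text \<open>Each 0 before the first 1 of the first argument removes one block of \<open>t\<close>;
  \<open>num\<close> of what remains is \<open>blocks t k\<close>. The result can be
  \<open>zeros\<close>, hence the \<open>normT\<close> in \<open>trm_of\<close>.\<close>

lemma I_OApp: "is_num v k \<Longrightarrow> I OApp [v, StreamV t] = StreamV ((drop_block ^^ k) t)"
proof -
  assume "is_num v k"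
  then obtain s where s: "v = StreamV s" "represents s k" by (auto simp: is_num_def)
  from s(2) have "I OApp [StreamV s, StreamV t] = StreamV ((drop_block ^^ k) t)"
    by (induction rule: represents.induct) (simp_all add: equations I_ODrop)
  with s show ?thesis by simp
qed

lemma I_OEq:
  assumes "is_num v k" "is_num w l"
  shows "I OEq [v, w] = BitV (k = l)"
proof -
  obtain s t where st: "v = StreamV s" "represents s k" "w = StreamV t" "represents t l"
    using assms by (auto simp: is_num_def)
  from st(2,4) have "I OEq [StreamV s, StreamV t] = BitV (k = l)"
  proof (induction arbitrary: t l rule: represents.induct)
    case (represents_One s)
    then show ?case by cases (simp_all add: equations)
  next
    case (represents_Zero s k)
    from represents_Zero.prems represents_Zero.IH show ?case by cases (simp_all add: equations)
  qed
  with st show ?thesis by simp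
qed

lemma eval_trm_of: "is_num (eval_trm A (asg b r) (trm_of a)) (aval r a)"
proof (induction a)
  case (NVar x)
  then show ?case using norm_num by (simp add: aval_def)
next
  case NZero
  then show ?case by (simp add: aval_def is_num_def)
next
  case (NSuc a)
  then show ?case using is_num_Suc by (simp add: aval_def)
next
  case (NAdd a b)
  then show ?case using is_num_add by (simp add: aval_def)
next
  case (NMul a b)
  then show ?case using is_num_mul by (simp add: aval_def)
next
  case (FApp F a)
  then show ?case using norm_num by (simp add: I_OApp) (simp add: aval_def blocks_def)
qed

lemma eval_OEq_trm_of:
  "I OEq [eval_trm A (asg b r) (trm_of a), eval_trm A (asg b r) (trm_of a')] = BitV (aval r a = aval r a')"
  by (rule I_OEq; rule eval_trm_of)

text \<open>Induction on the formula. For \<open>SEx\<close>, the Skolem value is a witness whenever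
  the symbol is true, and the second equation makes the symbol true as soon as any witness exists.
  So the truth symbols are determined, whichever Skolem functions the model has. That these return
  streams is a hypothesis of its own, as \<open>base_model\<close> does not type them.\<close>

lemma I_OHolds:
  assumes "\<And>e. e \<in> form_eqs m p \<Longrightarrow> satisfies A e"
    and "\<And>j q r. op_sym (OSk m j q) \<in> form_syms m p \<Longrightarrow> \<exists>z. I (OSk m j q) (env m r) = StreamV z"
    and "bounded m p"
  shows "I (OHolds m p) (env m r) = BitV (ssat r p)"
  using assms
proof (induction p arbitrary: r)
  case (SEq a b)
  then have "satisfies A (holdsT m (SEq a b) (vars m), ap OEq [trm_of a, trm_of b])" by simp
  then show ?case by (simp add: satisfies_def eval_OEq_trm_of)
next
  case (SNand p q)
  then have "satisfies A (holdsT m (SNand p q) (vars m),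
      ap ONand [holdsT m p (vars m), holdsT m q (vars m)])" by simp
  with SNand show ?case by (simp add: satisfies_def)
next
  case (SEx j p)
  have IH: "I (OHolds m p) (env m r) = BitV (ssat r p)" for r
    using SEx.prems by (intro SEx.IH) auto
  have "satisfies A (holdsT m (SEx j p) (vars m),
      holdsT m p ((vars m)[j := ap (OSk m j p) (vars m)]))"
    using SEx.prems by simp
  moreover obtain z where "I (OSk m j p) (env m r) = StreamV z"
    using SEx.prems(2)[of j p r] by auto
  ultimately have ex: "I (OHolds m (SEx j p)) (env m r) = BitV (ssat (r(j := z)) p)"
    by (simp add: satisfies_def env_update IH)
  \<comment> \<open>Nand of \<open>P\<close> with the negation of \<open>Q\<close> is the
    implication from \<open>P\<close> to \<open>Q\<close>.\<close>
  have "satisfies A (ap ONand [holdsT m p ((vars m)[j := Var Stream m]),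
      ap ONand [holdsT m (SEx j p) (vars m), holdsT m (SEx j p) (vars m)]], oneT)"
    using SEx.prems by simp
  then have eq: "I ONand [I (OHolds m p) ((env m r)[j := StreamV (r m)]),
      I ONand [I (OHolds m (SEx j p)) (env m r), I (OHolds m (SEx j p)) (env m r)]] = BitV True" for r
    by (simp add: satisfies_def)
  \<comment> \<open>The candidate \<open>s\<close> is put into stream variable \<open>m\<close>,
    which \<open>env m\<close> does not read.\<close>
  have "ssat (r(j := z)) p" if "ssat (r(j := s)) p" for s
    using eq[of "r(m := s)"] that by (simp add: env_upd_beyond env_update ex IH)
  with ex show ?case by auto
qed

lemma eval_numT: "eval_trm A \<rho> (numT k) = StreamV (numeral_stream k)"
  by (induction k) simp_all

end

section \<open>Truth of the formula from a full model\<close>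

definition query_env :: "nat \<Rightarrow> nat \<Rightarrow> stream" where
  "query_env x i = (if i = 0 then numeral_stream x else zeros)"

lemma (in base_model) satisfies_query_iff:
  assumes "0 < m"
  shows "satisfies A (query m p x) \<longleftrightarrow> I (OHolds m p) (env m (query_env x)) = BitV True"
proof -
  have "StreamV (numeral_stream x) # replicate (m - 1) (StreamV zeros) = env m (query_env x)"
    using assms by (intro nth_equalityI) (auto simp: env_def query_env_def nth_Cons split: nat.split)
  then show ?thesis
    by (simp add: satisfies_def query_def eval_numT)
qed

lemma interp_in_carrier:
  assumes "stream_algebra S A" and "f \<in> S"
    and "list_all2 (\<lambda>v s. v \<in> carrier_of A s) vs (arg_sorts f)"
  shows "interp A f vs \<in> carrier_of A (res_sort f)"
  using assms unfolding stream_algebra_def by blast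

lemma full_base_model:
  assumes "full A" "model S E A" "base_syms \<subseteq> S" "base_eqs \<subseteq> E"
  shows "base_model A"
proof
  have sa: "stream_algebra S A" and sat: "\<forall>e\<in>E. satisfies A e"
    using assms(1,2) by (simp_all add: model_full_iff)
  show "interp A Zero [] = BitV False" "interp A One [] = BitV True"
    "interp A SCons [BitV b, StreamV s] = StreamV (case_nat b s)" for b s
    using sa assms(1) unfolding stream_algebra_def full_def by blast+
  have "op_sym OZeros \<in> S" using assms(3) base_symsI by blast
  then have "interp A (op_sym OZeros) [] \<in> carrier_of A Stream"
    using interp_in_carrier[OF sa, of "op_sym OZeros" "[]"] by simp
  then show "\<exists>z. interp A (op_sym OZeros) [] = StreamV z" by auto
  show "satisfies A e" if "e \<in> base_eqs" for e
    using that sat assms(4) by blast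
qed

text \<open>The query sets the truth symbol to 1 at \<open>query_env x\<close>, where its forced
  value is the truth value of \<open>p\<close>. The sorts of the signature make Skolem values
  streams.\<close>

lemma ssat_of_model:
  assumes "full A" and mod: "model (spec_syms m p) (spec_eqs m p x) A"
    and "bounded m p" and "0 < m"
  shows "ssat (query_env x) p"
proof -
  interpret base_model A
    by (rule full_base_model[OF assms(1,2)]) auto
  note sa_sat = iffD1[OF model_full_iff[OF assms(1)] mod]
  note sa = conjunct1[OF sa_sat] and sat = conjunct2[OF sa_sat]
  have "\<exists>z. I (OSk m j q) (env m r) = StreamV z" if "op_sym (OSk m j q) \<in> form_syms m p" for j q r
  proof -
    have "list_all2 (\<lambda>v s. v \<in> carrier_of A s) (env m r) (replicate m Stream)"
      using \<open>full A\<close> by (auto simp: list_all2_conv_all_nth env_def full_def)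
    then have "I (OSk m j q) (env m r) \<in> carrier_of A Stream"
      using interp_in_carrier[OF sa, of "op_sym (OSk m j q)"] that by simp
    then show ?thesis by auto
  qed
  then have "I (OHolds m p) (env m (query_env x)) = BitV (ssat (query_env x) p)"
    using sat assms(3) by (intro I_OHolds) auto
  moreover have "satisfies A (query m p x)" using sat by blast
  ultimately show ?thesis
    using assms(4) by (simp add: satisfies_query_iff)
qed


subsection \<open>The standard model\<close>

primrec st :: "val \<Rightarrow> stream" where
  "st (StreamV s) = s"
| "st (BitV b) = zeros"

primrec bt :: "val \<Rightarrow> bool" where
  "bt (BitV b) = b"
| "bt (StreamV s) = False"

text \<open>On \<open>zeros\<close> the recursion equation only asks for a fixed point of \<open>h\<close>, and \<open>zeros\<close> is one for
  every \<open>h\<close> used here.\<close>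

definition iter :: "(stream \<Rightarrow> stream) \<Rightarrow> stream \<Rightarrow> stream \<Rightarrow> stream" where
  "iter h d s = (if s = zeros then zeros else (h ^^ num s) d)"

lemma iter_True [simp]: "iter h d (case_nat True s) = d"
  by (simp add: iter_def num_eqI)

lemma iter_False: "h zeros = zeros \<Longrightarrow> iter h d (case_nat False s) = h (iter h d s)"
proof (cases "s = zeros")
  case False
  then obtain k where "represents s k" using ex_represents_iff by blast
  then have "num s = k" "num (case_nat False s) = Suc k" by (auto intro: num_eqI)
  with False show ?thesis by (simp add: iter_def)
qed (simp add: iter_def)

definition add_stream :: "stream \<Rightarrow> stream \<Rightarrow> stream" where
  "add_stream s t = iter (case_nat False) t s"

text \<open>Provides the fixed-point condition of \<open>iter_False\<close> for multiplication,
  which iterates \<open>add_stream t\<close>.\<close>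

lemma add_stream_zeros [simp]: "add_stream s zeros = zeros"
proof -
  have "(case_nat False ^^ k) zeros = zeros" for k by (induction k) simp_all
  then show ?thesis by (simp add: add_stream_def iter_def)
qed

definition env_of :: "val list \<Rightarrow> nat \<Rightarrow> stream" where
  "env_of vs i = (if i < length vs then st (vs ! i) else zeros)"

text \<open>Skolem symbols choose a witness when there is one, and \<open>OFree\<close> takes the
  parameter \<open>u\<close>, through which any stream can become a solution. \<open>OEq\<close> is
  false at \<open>zeros\<close>, as its recursion permits.\<close>

fun opr_sem :: "stream \<Rightarrow> opr \<Rightarrow> val list \<Rightarrow> val" where
  "opr_sem u OZeros vs = StreamV zeros"
| "opr_sem u OFree vs = StreamV u"
| "opr_sem u ONand vs = BitV (\<not> (bt (vs ! 0) \<and> bt (vs ! 1)))"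
| "opr_sem u OEx vs = BitV (st (vs ! 0) \<noteq> zeros)"
| "opr_sem u OFix vs = StreamV (if bt (vs ! 0) then st (vs ! 1) else case_nat True zeros)"
| "opr_sem u OAdd vs = StreamV (add_stream (st (vs ! 0)) (st (vs ! 1)))"
| "opr_sem u OMul vs =
     StreamV (iter (add_stream (st (vs ! 1))) (case_nat True zeros) (st (vs ! 0)))"
| "opr_sem u ODrop vs = StreamV (drop_block (st (vs ! 0)))"
| "opr_sem u OApp vs = StreamV (iter drop_block (st (vs ! 1)) (st (vs ! 0)))"
| "opr_sem u OEq vs = BitV (\<exists>k. represents (st (vs ! 0)) k \<and> represents (st (vs ! 1)) k)"
| "opr_sem u (OHolds m p) vs = BitV (ssat (env_of vs) p)"
| "opr_sem u (OSk m j p) vs = StreamV (SOME s. ssat ((env_of vs)(j := s)) p)"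

fun std_interp :: "stream \<Rightarrow> fsym \<Rightarrow> val list \<Rightarrow> val" where
  "std_interp u Zero vs = BitV False"
| "std_interp u One vs = BitV True"
| "std_interp u SCons vs = StreamV (case_nat (bt (vs ! 0)) (st (vs ! 1)))"
| "std_interp u (Fn k ss s) vs = opr_sem u (from_nat k) vs"

definition std :: "stream \<Rightarrow> alg" where
  "std u = \<lparr>streams = UNIV, interp = std_interp u\<rparr>"

lemma full_std [simp]: "full (std u)"
  by (simp add: full_def std_def)

lemma interp_std [simp]:
  "interp (std u) Zero vs = BitV False"
  "interp (std u) One vs = BitV True"
  "interp (std u) SCons vs = StreamV (case_nat (bt (vs ! 0)) (st (vs ! 1)))"
  "interp (std u) (op_sym f) vs = opr_sem u f vs"
  by (simp_all add: std_def op_sym_def)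

lemma streams_std [simp]: "streams (std u) = UNIV"
  by (simp add: std_def)

lemma form_syms_subset:
  "f \<in> form_syms m p \<Longrightarrow> f \<in> range op_sym"
  by (induction p) auto

lemma stream_algebra_std: "stream_algebra (spec_syms m p) (std u)"
proof -
  have "interp (std u) (op_sym f) vs \<in> carrier_of (std u) (opr_res f)" for f vs
    by (cases f) auto
  then have "interp (std u) f vs \<in> carrier_of (std u) (res_sort f)" if "f \<in> range op_sym" for f vs
    using that by auto
  moreover have "f \<in> range op_sym \<or> f = Zero \<or> f = One \<or> f = SCons" if "f \<in> spec_syms m p" for f
    using that form_syms_subset[of f m p] by (auto simp: base_syms_def)
  moreover have "interp (std u) f vs \<in> carrier_of (std u) (res_sort f)"
    if "f = Zero \<or> f = One \<or> f = SCons" for f vs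
    using that by (elim disjE) (simp_all add: rangeI)
  ultimately have "interp (std u) f vs \<in> carrier_of (std u) (res_sort f)" if "f \<in> spec_syms m p" for f vs
    using that by blast
  then show ?thesis
    by (simp add: stream_algebra_def)
qed

lemma satisfies_base_eqs_std: "e \<in> base_eqs \<Longrightarrow> satisfies (std u) e"
  by (auto simp: base_eqs_def Let_def satisfies_def iter_False add_stream_def[symmetric])
    (simp_all add: add_stream_def iter_False, blast+)

lemma base_model_std: "base_model (std u)"
  by unfold_locales (simp_all add: satisfies_base_eqs_std)

lemma length_env [simp]: "length (env m r) = m"
  by (simp add: env_def)

lemma env_of_env: "i < m \<Longrightarrow> env_of (env m r) i = r i"
  by (simp add: env_of_def env_def)

lemma env_of_update: "j < length vs \<Longrightarrow> env_of (vs[j := StreamV s]) = (env_of vs)(j := s)"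
  by (auto simp: env_of_def fun_eq_iff)

text \<open>For atoms, \<open>bounded\<close> makes \<open>env_of (env m r)\<close> agree with
  \<open>r\<close> on all variables that occur; for \<open>SEx\<close>, the choice made by
  \<open>OSk\<close> succeeds if any stream does.\<close>

lemma satisfies_form_eqs_std:
  "bounded m p \<Longrightarrow> e \<in> form_eqs m p \<Longrightarrow> satisfies (std u) e"
proof (induction p)
  case (SEq a b)
  have aval: "aval (env_of (env m r)) a = aval r a" "aval (env_of (env m r)) b = aval r b" for r
    using SEq.prems(1) by (auto intro!: aval_cong env_of_env)
  show ?case
    using SEq.prems(2) base_model.eval_OEq_trm_of[OF base_model_std, of u]
    by (simp add: satisfies_def aval del: opr_sem.simps(10))
next
  case (SNand p q)
  then show ?case by (auto simp: satisfies_def)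
next
  case (SEx j p)
  have some: "ssat (r(j := s)) p \<Longrightarrow> ssat (r(j := SOME s. ssat (r(j := s)) p)) p" for r s
    by (rule someI[of "\<lambda>s. ssat (r(j := s)) p"])
  with SEx show ?case
    by (auto simp: satisfies_def env_of_update intro: some)
qed

lemma model_std:
  assumes "ssat (query_env x) p" "bounded m p" "0 < m"
  shows "model (spec_syms m p) (spec_eqs m p x) (std u)"
proof -
  interpret base_model "std u" by (rule base_model_std)
  have "I (OHolds m p) (env m (query_env x)) = BitV (ssat (query_env x) p)"
    using satisfies_form_eqs_std[OF assms(2)] assms(2) by (intro I_OHolds) simp_all
  then have "satisfies (std u) (query m p x)"
    using assms by (simp add: satisfies_query_iff)
  then have "\<forall>e\<in>spec_eqs m p x. satisfies (std u) e"
    using assms(2) satisfies_form_eqs_std satisfies_base_eqs_std by blast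
  then show ?thesis
    by (simp add: model_full_iff stream_algebra_std)
qed

section \<open>Solution sets of the two ground terms\<close>

lemma ssat_query_env: "ssat (query_env x) (sform_of p) \<longleftrightarrow> x \<in> defined_set p"
proof -
  have "(\<lambda>y. num (query_env x (2 * y))) = (\<lambda>_. 0)(0 := x)"
    and "(\<lambda>F. blocks (query_env x (2 * F + 1))) = (\<lambda>_ _. 0)"
    by (auto simp: query_env_def)
  then show ?thesis
    by (simp add: ssat_sform_of defined_set_def)
qed

lemma sol_full_OZeros:
  assumes "bounded m p" "0 < m"
  shows "sol_full (spec_syms m p) (ap OZeros []) (spec_eqs m p x)
    = (if ssat (query_env x) p then {zeros} else {})"
proof (intro set_eqI iffI)
  fix s :: stream assume "s \<in> sol_full (spec_syms m p) (ap OZeros []) (spec_eqs m p x)"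
  then obtain A \<rho> where A: "full A" "model (spec_syms m p) (spec_eqs m p x) A"
    "eval_trm A \<rho> (ap OZeros []) = StreamV s"
    by (auto simp: sol_full_def)
  interpret base_model A
    by (rule full_base_model[OF A(1,2)]) auto
  show "s \<in> (if ssat (query_env x) p then {zeros} else {})"
    using A(3) ssat_of_model[OF A(1,2) assms] by simp
next
  fix s :: stream assume "s \<in> (if ssat (query_env x) p then {zeros} else {})"
  then have "ssat (query_env x) p" and "s = zeros" by (auto split: if_splits)
  from this(1) have "model (spec_syms m p) (spec_eqs m p x) (std zeros)"
    using model_std[OF _ assms] by blast
  moreover have "assignment (std zeros) (asg (\<lambda>_. False) (\<lambda>_. zeros))"
    using assignment_full_iff[OF full_std] by blast
  moreover have "eval_trm (std zeros) (asg (\<lambda>_. False) (\<lambda>_. zeros)) (ap OZeros []) = StreamV s"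
    by (simp add: \<open>s = zeros\<close>)
  ultimately show "s \<in> sol_full (spec_syms m p) (ap OZeros []) (spec_eqs m p x)"
    using full_std unfolding sol_full_def by blast
qed

text \<open>If \<open>p\<close> is true at the query, \<open>std s\<close> realises each stream
  \<open>s\<close>; otherwise no full model exists.\<close>

lemma sol_full_OFree:
  assumes "bounded m p" "0 < m"
  shows "sol_full (spec_syms m p) (ap OFree []) (spec_eqs m p x)
    = (if ssat (query_env x) p then UNIV else {})"
proof (intro set_eqI iffI)
  fix s :: stream assume "s \<in> sol_full (spec_syms m p) (ap OFree []) (spec_eqs m p x)"
  then obtain A where "full A" "model (spec_syms m p) (spec_eqs m p x) A"
    by (auto simp: sol_full_def)
  then show "s \<in> (if ssat (query_env x) p then UNIV else {})"
    using ssat_of_model[OF _ _ assms] by simp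
next
  fix s :: stream assume "s \<in> (if ssat (query_env x) p then UNIV else {})"
  then have "ssat (query_env x) p" by (auto split: if_splits)
  then have "model (spec_syms m p) (spec_eqs m p x) (std s)"
    using model_std[OF _ assms] by blast
  moreover have "assignment (std s) (asg (\<lambda>_. False) (\<lambda>_. zeros))"
    using assignment_full_iff[OF full_std] by blast
  moreover have "eval_trm (std s) (asg (\<lambda>_. False) (\<lambda>_. zeros)) (ap OFree []) = StreamV s"
    by simp
  ultimately show "s \<in> sol_full (spec_syms m p) (ap OFree []) (spec_eqs m p x)"
    using full_std unfolding sol_full_def by blast
qed

section \<open>Computability of the reductions\<close>

definition computable1 :: "(nat \<Rightarrow> nat) \<Rightarrow> bool" where
  "computable1 F \<longleftrightarrow> (\<exists>f. partrec 1 f \<and> (\<forall>a. f [a] = Some (F a)))"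

definition computable2 :: "(nat \<Rightarrow> nat \<Rightarrow> nat) \<Rightarrow> bool" where
  "computable2 F \<longleftrightarrow> (\<exists>f. partrec 2 f \<and> (\<forall>a b. f [a, b] = Some (F a b)))"

lemma partrec_comp1:
  assumes "computable1 F" "partrec n (\<lambda>xs. Some (G xs))"
  shows "partrec n (\<lambda>xs. Some (F (G xs)))"
proof -
  obtain f where f: "partrec 1 f" "\<And>a. f [a] = Some (F a)"
    using assms(1) by (auto simp: computable1_def)
  show ?thesis
    using partrec.comp[of "[\<lambda>xs. Some (G xs)]" f n] f assms(2) by simp
qed

lemma partrec_comp2:
  assumes "computable2 F" "partrec n (\<lambda>xs. Some (G xs))" "partrec n (\<lambda>xs. Some (H xs))"
  shows "partrec n (\<lambda>xs. Some (F (G xs) (H xs)))"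
proof -
  obtain f where f: "partrec 2 f" "\<And>a b. f [a, b] = Some (F a b)"
    using assms(1) by (auto simp: computable2_def)
  show ?thesis
    using partrec.comp[of "[\<lambda>xs. Some (G xs), \<lambda>xs. Some (H xs)]" f n] f assms(2,3)
    by (simp add: numeral_2_eq_2)
qed

lemma computable1_Suc: "computable1 Suc"
  using partrec.succ by (auto simp: computable1_def)

lemma partrec_const: "partrec n (\<lambda>xs. Some c)"
proof (induction c)
  case 0
  show ?case by (rule partrec.zero)
next
  case (Suc c)
  then show ?case by (rule partrec_comp1[OF computable1_Suc])
qed

text \<open>With total functions the binds of the recursion scheme never fail, leaving plain
  \<open>rec_nat\<close>.\<close>

lemma rec_nat_Some:
  "rec_nat (Some a) (\<lambda>i r. Option.bind r (\<lambda>v. Some (h i v))) n = Some (rec_nat a h n)"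
  by (induction n) auto

lemma computable2_rec:
  assumes "partrec 1 (\<lambda>xs. Some (G xs))" "partrec 3 (\<lambda>xs. Some (H xs))"
    and "\<And>b. F 0 b = G [b]" "\<And>a b. F (Suc a) b = H [a, F a b, b]"
  shows "computable2 F"
proof -
  have "partrec (Suc 1) (\<lambda>xs. rec_nat (Some (G (tl xs)))
      (\<lambda>i r. Option.bind r (\<lambda>v. Some (H (i # v # tl xs)))) (hd xs))"
    by (rule partrec.prec) (use assms(1,2) in \<open>simp_all add: numeral_3_eq_3\<close>)
  moreover have "rec_nat (G [b]) (\<lambda>i v. H [i, v, b]) a = F a b" for a b
    by (induction a) (simp_all add: assms(3,4))
  ultimately show ?thesis
    unfolding computable2_def rec_nat_Some
    by (intro exI conjI) (auto simp: numeral_2_eq_2)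
qed

lemma computable1_rec:
  assumes "partrec 2 (\<lambda>xs. Some (H xs))" "\<And>a. F (Suc a) = H [a, F a]"
  shows "computable1 F"
proof -
  have "partrec (Suc 0) (\<lambda>xs. rec_nat (Some (F 0))
      (\<lambda>i r. Option.bind r (\<lambda>v. Some (H (i # v # tl xs)))) (hd xs))"
    by (rule partrec.prec) (use partrec_const assms(1) in \<open>simp_all add: numeral_2_eq_2\<close>)
  moreover have "rec_nat (F 0) (\<lambda>i v. H [i, v]) a = F a" for a
    by (induction a) (simp_all add: assms(2))
  ultimately show ?thesis
    unfolding computable1_def rec_nat_Some
    by (intro exI conjI) auto
qed

lemma computable2_add: "computable2 (+)"
  by (rule computable2_rec[where G = "\<lambda>xs. xs ! 0" and H = "\<lambda>xs. Suc (xs ! 1)"])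
    (auto intro!: partrec_comp1[OF computable1_Suc] partrec.proj)

lemma computable1_triangle: "computable1 triangle"
  by (rule computable1_rec[where H = "\<lambda>xs. xs ! 1 + Suc (xs ! 0)"])
    (auto intro!: partrec_comp2[OF computable2_add] partrec_comp1[OF computable1_Suc] partrec.proj)

lemma computable1_power2: "computable1 (\<lambda>n. 2 ^ n)"
  by (rule computable1_rec[where H = "\<lambda>xs. xs ! 1 + xs ! 1"])
    (auto intro!: partrec_comp2[OF computable2_add] partrec.proj)

lemma partrec_add:
  "partrec n (\<lambda>xs. Some (G xs)) \<Longrightarrow> partrec n (\<lambda>xs. Some (H xs)) \<Longrightarrow>
    partrec n (\<lambda>xs. Some (G xs + H xs))"
  by (rule partrec_comp2[OF computable2_add])

lemma partrec_Suc:
  "partrec n (\<lambda>xs. Some (G xs)) \<Longrightarrow> partrec n (\<lambda>xs. Some (Suc (G xs)))"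
  by (rule partrec_comp1[OF computable1_Suc])

lemma partrec_prod_encode:
  assumes "partrec n (\<lambda>xs. Some (G xs))" "partrec n (\<lambda>xs. Some (H xs))"
  shows "partrec n (\<lambda>xs. Some (prod_encode (G xs, H xs)))"
  using assms unfolding prod_encode_def split
  by (intro partrec_add partrec_comp1[OF computable1_triangle])

lemma partrec_double:
  assumes "partrec n (\<lambda>xs. Some (G xs))"
  shows "partrec n (\<lambda>xs. Some (2 * G xs))"
  using partrec_add[OF assms assms] by (simp add: mult_2)

lemmas partrec_intros =
  partrec_const partrec_add partrec_Suc partrec_prod_encode partrec_double
  partrec_comp1[OF computable1_power2]

section \<open>Codes of the instances\<close>

lemma computable1_code_numT: "computable1 (\<lambda>x. code_trm (numT x))"
proof (rule computable1_rec)
  \<comment> \<open>The outer \<open>Suc (2 * _)\<close> marks an application, 2 is the code of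
    \<open>SCons\<close>, each inner \<open>Suc\<close> is a list cell and the last 0 the empty
    list; \<open>xs ! 1\<close> is the code of the preceding numeral.\<close>
  let ?H = "\<lambda>xs. Suc (2 * prod_encode (2, Suc (prod_encode (code_trm zeroT,
      Suc (prod_encode (xs ! 1, 0))))))"
  show "partrec 2 (\<lambda>xs. Some (?H xs))"
    by (intro partrec_intros partrec.proj) simp
  show "code_trm (numT (Suc x)) = ?H [x, code_trm (numT x)]" for x
    by (simp add: sum_encode_def)
qed

lemma computable1_code_query: "computable1 (\<lambda>x. code_eqn (query m p x))"
proof -
  let ?F = "\<lambda>c. prod_encode (Suc (2 * prod_encode (code_fsym (op_sym (OHolds m p)),
      Suc (prod_encode (c,
        list_encode (map code_trm (replicate (m - 1) zerosT)))))), code_trm oneT)"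
  have "partrec 1 (\<lambda>xs. Some (?F (code_trm (numT (xs ! 0)))))"
    by (intro partrec_intros partrec_comp1[OF computable1_code_numT] partrec.proj) simp
  moreover have "code_eqn (query m p x) = ?F (code_trm (numT x))" for x
    by (simp add: query_def sum_encode_def)
  ultimately show ?thesis
    unfolding computable1_def by fastforce
qed

text \<open>\<open>set_encode\<close> is a sum of powers of 2, so the query, being distinct from all
  other equations, adds the summand \<open>2 ^ c\<close>; the rest is constant in
  \<open>x\<close>.\<close>

lemma computable1_code_instance:
  assumes "0 < m"
  shows "computable1 (\<lambda>x. code_instance (spec_syms m p) (spec_eqs m p x) t)"
proof -
  let ?C = "set_encode (code_eqn ` (base_eqs \<union> form_eqs m p))"
  let ?F = "\<lambda>c. prod_encode (set_encode (code_fsym ` spec_syms m p),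
      prod_encode (2 ^ c + ?C, code_trm t))"
  have "partrec 1 (\<lambda>xs. Some (?F (code_eqn (query m p (xs ! 0)))))"
    by (intro partrec_intros partrec_comp1[OF computable1_code_query] partrec.proj) simp
  moreover have "code_instance (spec_syms m p) (spec_eqs m p x) t = ?F (code_eqn (query m p x))" for x
  proof -
    have "code_eqn (query m p x) \<notin> code_eqn ` (base_eqs \<union> form_eqs m p)"
      using query_notin[OF assms] by (metis code_eqn_inject imageE)
    then have "set_encode (code_eqn ` spec_eqs m p x) = 2 ^ code_eqn (query m p x) + ?C"
      by (subst image_insert, subst set_encode_insert) simp_all
    then show ?thesis
      by (simp add: code_instance_def)
  qed
  ultimately show ?thesis
    unfolding computable1_def by fastforce
qed

section \<open>Hardness\<close>

definition instances :: "((nat \<Rightarrow> bool) set \<Rightarrow> bool) \<Rightarrow> nat set" where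
  "instances Q =
     {code_instance S E t | S E t. problem_instance S E t \<and> Q (sol_full S t E)}"

lemma code_instance_in_instances_iff:
  "problem_instance S E t \<Longrightarrow> code_instance S E t \<in> instances Q \<longleftrightarrow> Q (sol_full S t E)"
  using code_instance_inject[of S E t] unfolding instances_def by blast

text \<open>The arity bound depends on \<open>p\<close> alone, so signature and clauses are fixed
  before \<open>x\<close> and only the query varies.\<close>

lemma many_one_reducible_instances:
  assumes "f = OZeros \<or> f = OFree"
    and "\<And>m x. bounded m p \<Longrightarrow> 0 < m \<Longrightarrow>
      x \<in> X \<longleftrightarrow> Q (sol_full (spec_syms m p) (ap f []) (spec_eqs m p x))"
  shows "many_one_reducible X (instances Q)"
proof -
  obtain n where "\<forall>m\<ge>n. bounded m p" using eventually_bounded by blast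
  then have m: "bounded (Suc n) p" "0 < Suc n" by simp_all
  obtain g where g: "partrec 1 g"
    "\<And>x. g [x] = Some (code_instance (spec_syms (Suc n) p) (spec_eqs (Suc n) p x) (ap f []))"
    using computable1_code_instance[OF m(2)] unfolding computable1_def by blast
  have "x \<in> X \<longleftrightarrow> (\<exists>y. g [x] = Some y \<and> y \<in> instances Q)" for x
    using code_instance_in_instances_iff[OF problem_instance_spec[OF m(2) assms(1)]]
      assms(2)[OF m] by (simp add: g(2))
  with g(1) show ?thesis
    unfolding many_one_reducible_def by blast
qed

lemma subsumes_analytical_hierarchyI:
  assumes "\<And>\<phi>. many_one_reducible (defined_set \<phi>) P"
  shows "subsumes_analytical_hierarchy P"
  using assms by (auto simp: subsumes_analytical_hierarchy_def Sigma11_def Pi11_def)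

theorem theorem4:
  shows "subsumes_analytical_hierarchy has_solution_problem \<and>
         subsumes_analytical_hierarchy unique_solution_problem \<and>
         subsumes_analytical_hierarchy at_most_one_solution_problem"
proof (intro conjI subsumes_analytical_hierarchyI)
  fix \<phi>
  have eq: "has_solution_problem = instances (\<lambda>T. T \<noteq> {})"
    by (simp add: has_solution_problem_def instances_def)
  show "many_one_reducible (defined_set \<phi>) has_solution_problem"
    unfolding eq by (rule many_one_reducible_instances[of OZeros "sform_of \<phi>"])
      (simp_all add: sol_full_OZeros ssat_query_env)
  have eq: "unique_solution_problem = instances (\<lambda>T. \<exists>!\<sigma>. \<sigma> \<in> T)"
    by (simp add: unique_solution_problem_def instances_def)
  show "many_one_reducible (defined_set \<phi>) unique_solution_problem"
    unfolding eq by (rule many_one_reducible_instances[of OZeros "sform_of \<phi>"])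
      (auto simp: sol_full_OZeros ssat_query_env)
  have eq: "at_most_one_solution_problem = instances (\<lambda>T. \<forall>\<sigma>\<in>T. \<forall>\<tau>\<in>T. \<sigma> = \<tau>)"
    by (simp add: at_most_one_solution_problem_def instances_def)
  \<comment> \<open>Shows that \<open>UNIV\<close>, the solution set when \<open>\<phi>\<close>
    fails, has more than one element.\<close>
  have "\<exists>\<sigma> \<tau> :: stream. \<sigma> \<noteq> \<tau>"
    using case_nat_True_neq_zeros by blast
  then show "many_one_reducible (defined_set \<phi>) at_most_one_solution_problem"
    unfolding eq by (intro many_one_reducible_instances[of OFree "SNeg (sform_of \<phi>)"])
      \<comment> \<open>\<open>SNeg\<close> abbreviates a \<open>SNand\<close>; unfolding its
        clauses would keep \<open>sol_full_OFree\<close> from matching.\<close>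
      (simp_all add: sol_full_OFree ssat_query_env del: form_eqs.simps form_syms.simps)
qed

end
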